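(* Let $(K,D,\star)$ be a complete probabilistic metric space such that $\star$ is continuous. Then the following assertions are equivalent. (1) $(K,D,\star)$ is compact. (2) The metric space $(Lip^1_\star(K,\Delta^+),d_\infty)$ is compact (or equivalently, $Lip^1_\star(K,\Delta^+)$ is a compact subset of $(C_\star(K,\Delta^+),d_\infty)=(C(K,\Delta^+),d_\infty)$).
   Context: $\Delta^+$ is the set of all nondecreasing functions $F:[-\infty,+\infty]\to[0,1]$, left-continuous on $\mathbb R$, with $F(-\infty)=0$, $F(0)=0$, $F(+\infty)=1$. For $a\ge 0$, $\mathcal H_a(t)=0$ if $t\le a$ and $\mathcal H_a(t)=1$ if $t>a$. Order: $F\le L$ iff $F(t)\le L(t)$ for all $t\in\mathbb R$. Modified Lévy distance: for $F,L\in\Delta^+$ and $h>0$ let $A^h_{F,L}=\{t\ge 0: L(t)\le F(t+h)+h\}$, and $d_{\mathcal L}(F,L)=\inf\{h>0:[0,h^{-1})\subset A^h_{F,L}\cap A^h_{L,F}\}$. It is known that $d_{\mathcal L}$ is a metric on $\Delta^+$, that $(\Delta^+,d_{\mathcal L})$ is compact, and that $d_{\mathcal L}(F_n,F)\to0$ iff $F_n\to F$ weakly, i.e. $F_n(t)\to F(t)$ at every continuity point $t$ of $F$. A triangle function is a binary operation $\star$ on $\Delta^+$ that is commutative, associative, nondecreasing in each place, with neutral element $\mathcal H_0$. It is continuous if $F_n\to F$ and $L_n\to L$ weakly imply $F_n\star L_n\to F\star L$ weakly (equivalently, it is continuous for $d_{\mathcal L}$). A probabilistic metric space $(K,D,\star)$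 is a set $K$ with a triangle function $\star$ and a map $D:K\times K\to\Delta^+$ such that $D(x,y)=\mathcal H_0$ iff $x=y$; $D(x,y)=D(y,x)$; and $D(x,y)\star D(y,z)\le D(x,z)$ for all $x,y,z\in K$. A sequence $(z_n)$ in $K$ is Cauchy if $\lim_{n,p\to\infty}D(z_n,z_p)(t)=\mathcal H_0(t)$ for all $t\in\mathbb R$ (equivalently $d_{\mathcal L}(D(z_n,z_p),\mathcal H_0)\to0$). The space is complete if for every Cauchy sequence $(z_n)$ there is $z_\infty\in K$ with $\lim_n D(z_n,z_\infty)(t)=\mathcal H_0(t)$ for all $t\in\mathbb R$. With $N_x(t)=\{y\in K:D(x,y)(t)>1-t\}$ for $t>0$ (known: $y\in N_x(t)$ iff $d_{\mathcal L}(D(x,y),\mathcal H_0)<t$), a complete probabilistic metric space is called compact if for every $t>0$ the cover $\{N_x(t):x\in K\}$ of $K$ has a finite subcover. $\sigma_D(x,y):=\sup_{z\in K}d_{\mathcal L}(D(x,z),D(y,z))$ is a metric on $K$. $C(K,\Delta^+)$ is the set of continuous functions $(K,\sigma_D)\to(\Delta^+,d_{\mathcal L})$. $C_\star(K,\Delta^+)$ is the set of $f:K\to\Delta^+$ such that for every $z\in K$ and every sequence $(z_n)$ in $K$, $d_{\mathcal L}(D(z_n,z),\mathcal H_0)\to0$ implies $d_{\mathcal L}(f(z_n),f(z))\to0$. $Lip^1_\star(K,\Delta^+)$ is the set of probabilistic $1$-Lipschitz maps, i.e. $f:K\to\Delta^+$ with $D(x,y)\star f(y)\le f(x)$ for all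 $x,y\in K$. The uniform metric is $d_\infty(f,g)=\sup_{x\in K}d_{\mathcal L}(f(x),g(x))$. *)

theory Defs
  imports "HOL-Analysis.Analysis"
begin

section \<open>Distance distribution functions\<close>

lemma heaviside_left_continuous:
  "continuous (at_left (ereal t)) (\<lambda>s. if s \<le> (0::ereal) then 0 else (1::real))"
proof (cases "t \<le> 0")
  case True
  have "eventually (\<lambda>s. s < ereal t) (at_left (ereal t))"
    by (simp add: eventually_at_filter)
  then have "eventually (\<lambda>s. (if s \<le> (0::ereal) then 0 else (1::real)) = 0) (at_left (ereal t))"
  proof eventually_elim
    case (elim s)
    also have "ereal t \<le> 0" using True by simp
    finally show ?case by simp
  qed
  then show ?thesis
    using True by (simp add: continuous_within tendsto_eventually)
next
  case False
  have "eventually (\<lambda>s. s \<in> {0<..<ereal t}) (at_left (ereal t))"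
    using False by (intro eventually_at_leftI[of 0]) auto
  then have "eventually (\<lambda>s. (if s \<le> (0::ereal) then 0 else (1::real)) = 1) (at_left (ereal t))"
    by eventually_elim auto
  then show ?thesis
    using False by (simp add: continuous_within tendsto_eventually)
qed

typedef ddf =
  "{F :: ereal \<Rightarrow> real. mono F \<and> range F \<subseteq> {0..1} \<and>
      (\<forall>t::real. continuous (at_left (ereal t)) F) \<and>
      F (-\<infinity>) = 0 \<and> F 0 = 0 \<and> F \<infinity> = 1}"
  morphisms dfun Abs_ddf
proof
  show "(\<lambda>s. if s \<le> (0::ereal) then 0 else (1::real)) \<in>
    {F. mono F \<and> range F \<subseteq> {0..1} \<and> (\<forall>t::real. continuous (at_left (ereal t)) F) \<and>
      F (-\<infinity>) = 0 \<and> F 0 = 0 \<and> F \<infinity> = 1}"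
    using heaviside_left_continuous by (auto simp: mono_def)
qed

definition H0 :: ddf where
  "H0 = Abs_ddf (\<lambda>s. if s \<le> 0 then 0 else 1)"

lemma dfun_H0: "dfun H0 s = (if s \<le> 0 then 0 else 1)"
  unfolding H0_def using heaviside_left_continuous
  by (subst Abs_ddf_inverse) (auto simp: mono_def)

lemma dfun_mono: "s \<le> t \<Longrightarrow> dfun F s \<le> dfun F t"
  using dfun[of F] by (auto dest: monoD)

lemma dfun_bounds: "0 \<le> dfun F t" "dfun F t \<le> 1"
  using dfun[of F] by (auto simp: image_subset_iff)

lemma dfun_left_continuous: "continuous (at_left (ereal t)) (dfun F)"
  using dfun[of F] by auto

lemma dfun_nonpos: "t \<le> 0 \<Longrightarrow> dfun F t = 0"
  using dfun[of F] dfun_mono[of t 0 F] dfun_bounds(1)[of F t] by auto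

lemma dfun_infinity [simp]: "dfun F \<infinity> = 1"
  using dfun[of F] by auto

lemma ddf_eqI:
  assumes "\<And>t::real. 0 < t \<Longrightarrow> dfun F (ereal t) = dfun L (ereal t)"
  shows "F = L"
proof -
  have "dfun F s = dfun L s" for s
  proof (cases s)
    case (real r)
    then show ?thesis
      using assms by (cases "r \<le> 0") (auto simp: dfun_nonpos)
  qed (auto simp: dfun_nonpos)
  then show ?thesis
    by (simp add: dfun_inject[symmetric] fun_eq_iff)
qed

instantiation ddf :: order
begin

definition less_eq_ddf :: "ddf \<Rightarrow> ddf \<Rightarrow> bool" where
  "F \<le> L \<longleftrightarrow> (\<forall>t::real. dfun F (ereal t) \<le> dfun L (ereal t))"

definition less_ddf :: "ddf \<Rightarrow> ddf \<Rightarrow> bool" where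
  "F < L \<longleftrightarrow> F \<le> L \<and> \<not> L \<le> F" for F L :: ddf

instance
proof
  fix F L G :: ddf
  show "F \<le> L \<Longrightarrow> L \<le> G \<Longrightarrow> F \<le> G"
    unfolding less_eq_ddf_def by (meson order_trans)
  show "F \<le> L \<Longrightarrow> L \<le> F \<Longrightarrow> F = L"
    unfolding less_eq_ddf_def by (intro ddf_eqI order_antisym) auto
qed (auto simp: less_ddf_def less_eq_ddf_def)

end

definition weak_conv_ddf :: "(nat \<Rightarrow> ddf) \<Rightarrow> ddf \<Rightarrow> bool" where
  "weak_conv_ddf Fs F \<longleftrightarrow>
     (\<forall>t::real. isCont (dfun F) (ereal t) \<longrightarrow>
        (\<lambda>n. dfun (Fs n) (ereal t)) \<longlonglongrightarrow> dfun F (ereal t))"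


section \<open>The modified Levy distance\<close>

definition levy_set :: "ddf \<Rightarrow> ddf \<Rightarrow> real \<Rightarrow> real set" where
  "levy_set F L h = {t. 0 \<le> t \<and> dfun L (ereal t) \<le> dfun F (ereal (t + h)) + h}"

definition levy_dist :: "ddf \<Rightarrow> ddf \<Rightarrow> real" where
  "levy_dist F L = Inf {h. 0 < h \<and> {0..<inverse h} \<subseteq> levy_set F L h \<inter> levy_set L F h}"

definition levy_adm :: "ddf \<Rightarrow> ddf \<Rightarrow> real \<Rightarrow> bool" where
  "levy_adm F L h \<longleftrightarrow> 0 < h \<and> {0..<inverse h} \<subseteq> levy_set F L h \<inter> levy_set L F h"

lemma levy_admI:
  assumes "0 < h"
    and "\<And>t. \<lbrakk>0 \<le> t; t < inverse h\<rbrakk> \<Longrightarrow> dfun L (ereal t) \<le> dfun F (ereal (t + h)) + h"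
    and "\<And>t. \<lbrakk>0 \<le> t; t < inverse h\<rbrakk> \<Longrightarrow> dfun F (ereal t) \<le> dfun L (ereal (t + h)) + h"
  shows "levy_adm F L h"
  using assms by (auto simp: levy_adm_def levy_set_def)

lemma levy_admD:
  assumes "levy_adm F L h"
  shows "0 < h"
    and "\<lbrakk>0 \<le> t; t < inverse h\<rbrakk> \<Longrightarrow> dfun L (ereal t) \<le> dfun F (ereal (t + h)) + h"
    and "\<lbrakk>0 \<le> t; t < inverse h\<rbrakk> \<Longrightarrow> dfun F (ereal t) \<le> dfun L (ereal (t + h)) + h"
  using assms by (force simp: levy_adm_def levy_set_def subset_iff)+

lemma levy_adm_sym: "levy_adm F L h = levy_adm L F h"
  by (auto simp: levy_adm_def)

lemma levy_adm_ge_1: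
  assumes "1 \<le> h" shows "levy_adm F L h"
proof (rule levy_admI)
  show "0 < h" using assms by simp
  fix t :: real
  show "dfun L (ereal t) \<le> dfun F (ereal (t + h)) + h"
    using assms dfun_bounds[of L "ereal t"] dfun_bounds[of F "ereal (t + h)"] by linarith
  show "dfun F (ereal t) \<le> dfun L (ereal (t + h)) + h"
    using assms dfun_bounds[of F "ereal t"] dfun_bounds[of L "ereal (t + h)"] by linarith
qed

lemma levy_adm_mono:
  assumes "levy_adm F L h" "h \<le> h'"
  shows "levy_adm F L h'"
proof (rule levy_admI)
  have h: "0 < h" by (rule levy_admD[OF assms(1)])
  then show "0 < h'" using assms by simp
  fix t :: real assume t: "0 \<le> t" "t < inverse h'"
  then have "t < inverse h"
    using h assms(2) le_imp_inverse_le[of h h'] by linarith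
  note 1 = levy_admD(2,3)[OF assms(1) t(1) this]
  show "dfun L (ereal t) \<le> dfun F (ereal (t + h')) + h'"
    using 1 assms(2) dfun_mono[of "ereal (t + h)" "ereal (t + h')" F] by simp
  show "dfun F (ereal t) \<le> dfun L (ereal (t + h')) + h'"
    using 1 assms(2) dfun_mono[of "ereal (t + h)" "ereal (t + h')" L] by simp
qed

lemma levy_adm_trans:
  assumes "levy_adm F G h" "levy_adm G L k"
  shows "levy_adm F L (h + k)"
proof (cases "h + k < 1")
  case True
  have pos: "0 < h" "0 < k" using assms by (auto dest: levy_admD(1))
  show ?thesis
  proof (rule levy_admI)
    show "0 < h + k" using pos by simp
    fix t :: real assume t: "0 \<le> t" "t < inverse (h + k)"
    have gap: "inverse (h + k) + a \<le> inverse b"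
      if "0 < a" "0 < b" "a + b = h + k" for a b
    proof -
      have "b * (a + b) \<le> 1"
        using that True by (simp add: mult_le_one)
      then have "a * (b * (a + b)) \<le> a"
        using that by (simp add: mult_left_le)
      then show ?thesis
        unfolding that(3)[symmetric] using that(1,2) by (simp add: field_simps)
    qed
    have lt: "t < inverse h" "t < inverse k" "t + k < inverse h" "t + h < inverse k"
      using t gap[of k h] gap[of h k] pos by simp_all
    show "dfun L (ereal t) \<le> dfun F (ereal (t + (h + k))) + (h + k)"
      using levy_admD(2)[OF assms(2) t(1) lt(2)] levy_admD(2)[OF assms(1) _ lt(3)] t(1) pos
      by (simp add: ac_simps)
    show "dfun F (ereal t) \<le> dfun L (ereal (t + (h + k))) + (h + k)"
      using levy_admD(3)[OF assms(1) t(1) lt(1)] levy_admD(3)[OF assms(2) _ lt(4)] t(1) pos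
      by (simp add: ac_simps)
  qed
qed (simp add: levy_adm_ge_1)

lemma levy_dist_eq: "levy_dist F L = Inf {h. levy_adm F L h}"
  by (simp add: levy_dist_def levy_adm_def)

lemma levy_adm_bdd_below: "bdd_below {h. levy_adm F L h}"
  by (rule bdd_belowI[of _ 0]) (auto dest: levy_admD(1))

lemma levy_adm_nonempty: "{h. levy_adm F L h} \<noteq> {}"
  using levy_adm_ge_1[of 1 F L] by auto

lemma levy_dist_nonneg: "0 \<le> levy_dist F L"
  unfolding levy_dist_eq
  by (rule cInf_greatest[OF levy_adm_nonempty]) (auto dest: levy_admD(1))

lemma levy_dist_le: "levy_adm F L h \<Longrightarrow> levy_dist F L \<le> h"
  unfolding levy_dist_eq by (rule cInf_lower[OF _ levy_adm_bdd_below]) simp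

lemma levy_dist_less_iff: "levy_dist F L < h \<longleftrightarrow> (\<exists>k<h. levy_adm F L k)"
  unfolding levy_dist_eq
  using cInf_less_iff[OF levy_adm_nonempty levy_adm_bdd_below, of F L h] by auto

lemma levy_dist_le_1: "levy_dist F L \<le> 1"
  by (rule levy_dist_le) (rule levy_adm_ge_1, simp)

lemma levy_dist_sym: "levy_dist F L = levy_dist L F"
  by (simp add: levy_dist_eq levy_adm_sym[of F L])

lemma levy_dist_triangle: "levy_dist F L \<le> levy_dist F G + levy_dist G L"
proof (rule field_le_epsilon)
  fix e :: real assume e: "0 < e"
  obtain h where h: "h < levy_dist F G + e / 2" "levy_adm F G h"
    using e levy_dist_less_iff[of F G "levy_dist F G + e / 2"] by auto
  obtain k where k: "k < levy_dist G L + e / 2" "levy_adm G L k"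
    using e levy_dist_less_iff[of G L "levy_dist G L + e / 2"] by auto
  show "levy_dist F L \<le> levy_dist F G + levy_dist G L + e"
    using levy_dist_le[OF levy_adm_trans[OF h(2) k(2)]] h(1) k(1) by linarith
qed

lemma levy_dist_zero_le:
  assumes "levy_dist F L = 0" "0 < t"
  shows "dfun L (ereal t) \<le> dfun F (ereal t)"
proof -
  have adm: "levy_adm F L h" if "0 < h" for h
    using assms(1) that levy_dist_less_iff[of F L h] by (auto intro: levy_adm_mono)
  have ev: "\<forall>\<^sub>F s in at_left t. dfun L (ereal s) \<le> dfun F (ereal t) + (t - s)"
  proof (rule eventually_at_leftI)
    show "max 0 (t - inverse t) < t" using assms(2) by auto
    fix s assume s: "s \<in> {max 0 (t - inverse t)<..<t}"
    have "s < inverse (t - s)"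
    proof -
      have "inverse (inverse t) < inverse (t - s)"
        using s by (intro less_imp_inverse_less) auto
      then show ?thesis using s by simp
    qed
    then show "dfun L (ereal s) \<le> dfun F (ereal t) + (t - s)"
      using levy_admD(2)[OF adm[of "t - s"], of s] s by simp
  qed
  have "(dfun L \<longlongrightarrow> dfun L (ereal t)) (at_left (ereal t))"
    using dfun_left_continuous by (simp add: continuous_within)
  then have "((\<lambda>s. dfun L (ereal s)) \<longlongrightarrow> dfun L (ereal t)) (at_left t)"
    by (simp add: at_left_ereal filterlim_filtermap)
  moreover have "((\<lambda>s. dfun F (ereal t) + (t - s)) \<longlongrightarrow> dfun F (ereal t) + (t - t)) (at_left t)"
    by (intro tendsto_intros)
  ultimately show ?thesis
    using tendsto_le[OF _ _ _ ev] by fastforce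
qed

instantiation ddf :: metric_space
begin

definition dist_ddf :: "ddf \<Rightarrow> ddf \<Rightarrow> real" where
  "dist_ddf = levy_dist"

definition uniformity_ddf :: "(ddf \<times> ddf) filter" where
  "uniformity_ddf = (INF e\<in>{0<..}. principal {(F, L). dist F L < e})"

definition open_ddf :: "ddf set \<Rightarrow> bool" where
  "open_ddf U \<longleftrightarrow> (\<forall>F\<in>U. eventually (\<lambda>(F', L). F' = F \<longrightarrow> L \<in> U) uniformity)"

instance
proof
  fix F L G :: ddf
  show "dist F L = 0 \<longleftrightarrow> F = L"
  proof
    assume "dist F L = 0"
    then have "levy_dist F L = 0" "levy_dist L F = 0"
      by (simp_all add: dist_ddf_def levy_dist_sym)
    then show "F = L"
      by (intro ddf_eqI order_antisym) (auto intro: levy_dist_zero_le)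
  next
    assume "F = L"
    have "levy_adm F F h" if "0 < h" for h
    proof -
      have "dfun F (ereal t) \<le> dfun F (ereal (t + h)) + h" for t
        using that dfun_mono[of "ereal t" "ereal (t + h)" F] by simp
      then show ?thesis
        using that by (intro levy_admI)
    qed
    then have "levy_dist F F \<le> 0 + h" if "0 < h" for h
      using that by (simp add: levy_dist_le)
    then have "levy_dist F F \<le> 0"
      by (rule field_le_epsilon)
    then show "dist F L = 0"
      using \<open>F = L\<close> levy_dist_nonneg[of F F] by (simp add: dist_ddf_def)
  qed
  show "dist F L \<le> dist F G + dist L G"
    using levy_dist_triangle[of F L G] unfolding dist_ddf_def levy_dist_sym[of L G] .
qed (simp_all add: uniformity_ddf_def open_ddf_def)

end


section \<open>Triangle functions and probabilistic metric spaces\<close>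

definition triangle_function :: "(ddf \<Rightarrow> ddf \<Rightarrow> ddf) \<Rightarrow> bool" where
  "triangle_function star \<longleftrightarrow>
     (\<forall>F L. star F L = star L F) \<and>
     (\<forall>F L G. star (star F L) G = star F (star L G)) \<and>
     (\<forall>F F' L. F \<le> F' \<longrightarrow> star F L \<le> star F' L) \<and>
     (\<forall>F L L'. L \<le> L' \<longrightarrow> star F L \<le> star F L') \<and>
     (\<forall>F. star H0 F = F \<and> star F H0 = F)"

definition continuous_triangle_function :: "(ddf \<Rightarrow> ddf \<Rightarrow> ddf) \<Rightarrow> bool" where
  "continuous_triangle_function star \<longleftrightarrow>
     triangle_function star \<and>
     (\<forall>Fs F Ls L. weak_conv_ddf Fs F \<longrightarrow> weak_conv_ddf Ls L \<longrightarrow>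
        weak_conv_ddf (\<lambda>n. star (Fs n) (Ls n)) (star F L))"

definition prob_metric_space ::
  "'a set \<Rightarrow> ('a \<Rightarrow> 'a \<Rightarrow> ddf) \<Rightarrow> (ddf \<Rightarrow> ddf \<Rightarrow> ddf) \<Rightarrow> bool" where
  "prob_metric_space K D star \<longleftrightarrow>
     triangle_function star \<and>
     (\<forall>x\<in>K. \<forall>y\<in>K. D x y = H0 \<longleftrightarrow> x = y) \<and>
     (\<forall>x\<in>K. \<forall>y\<in>K. D x y = D y x) \<and>
     (\<forall>x\<in>K. \<forall>y\<in>K. \<forall>z\<in>K. star (D x y) (D y z) \<le> D x z)"

definition prob_Cauchy :: "('a \<Rightarrow> 'a \<Rightarrow> ddf) \<Rightarrow> (nat \<Rightarrow> 'a) \<Rightarrow> bool" where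
  "prob_Cauchy D z \<longleftrightarrow>
     (\<forall>t::real. ((\<lambda>(n, p). dfun (D (z n) (z p)) (ereal t)) \<longlongrightarrow> dfun H0 (ereal t))
        (sequentially \<times>\<^sub>F sequentially))"

definition prob_complete :: "'a set \<Rightarrow> ('a \<Rightarrow> 'a \<Rightarrow> ddf) \<Rightarrow> bool" where
  "prob_complete K D \<longleftrightarrow>
     (\<forall>z. range z \<subseteq> K \<and> prob_Cauchy D z \<longrightarrow>
        (\<exists>x\<in>K. \<forall>t::real. (\<lambda>n. dfun (D (z n) x) (ereal t)) \<longlonglongrightarrow> dfun H0 (ereal t)))"

definition prob_nbhd :: "'a set \<Rightarrow> ('a \<Rightarrow> 'a \<Rightarrow> ddf) \<Rightarrow> 'a \<Rightarrow> real \<Rightarrow> 'a set" where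
  "prob_nbhd K D x t = {y \<in> K. dfun (D x y) (ereal t) > 1 - t}"

definition prob_compact :: "'a set \<Rightarrow> ('a \<Rightarrow> 'a \<Rightarrow> ddf) \<Rightarrow> bool" where
  "prob_compact K D \<longleftrightarrow>
     prob_complete K D \<and>
     (\<forall>t>0. \<exists>A. finite A \<and> A \<subseteq> K \<and> K \<subseteq> (\<Union>x\<in>A. prob_nbhd K D x t))"


section \<open>Function spaces\<close>

text \<open>
  Functions on \<open>K\<close> are represented by extensional functions, so that two of them are equal
  as soon as they agree on \<open>K\<close>.  The supremum over the empty set, which is unspecified
  for real numbers, is taken to be 0.
\<close>

definition sup_dist :: "'a set \<Rightarrow> ('a \<Rightarrow> ddf) \<Rightarrow> ('a \<Rightarrow> ddf) \<Rightarrow> real" where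
  "sup_dist K f g = (if K = {} then 0 else (SUP x\<in>K. dist (f x) (g x)))"

definition sigma_dist :: "'a set \<Rightarrow> ('a \<Rightarrow> 'a \<Rightarrow> ddf) \<Rightarrow> 'a \<Rightarrow> 'a \<Rightarrow> real" where
  "sigma_dist K D x y = sup_dist K (D x) (D y)"

definition C_sigma :: "'a set \<Rightarrow> ('a \<Rightarrow> 'a \<Rightarrow> ddf) \<Rightarrow> ('a \<Rightarrow> ddf) set" where
  "C_sigma K D =
     {f \<in> extensional K.
        continuous_map (Metric_space.mtopology K (sigma_dist K D)) euclidean f}"

definition C_star :: "'a set \<Rightarrow> ('a \<Rightarrow> 'a \<Rightarrow> ddf) \<Rightarrow> ('a \<Rightarrow> ddf) set" where
  "C_star K D =
     {f \<in> extensional K.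
        \<forall>z\<in>K. \<forall>zs. range zs \<subseteq> K \<longrightarrow>
          (\<lambda>n. dist (D (zs n) z) H0) \<longlonglongrightarrow> 0 \<longrightarrow>
          (\<lambda>n. dist (f (zs n)) (f z)) \<longlonglongrightarrow> 0}"

definition Lip1_star ::
  "'a set \<Rightarrow> ('a \<Rightarrow> 'a \<Rightarrow> ddf) \<Rightarrow> (ddf \<Rightarrow> ddf \<Rightarrow> ddf) \<Rightarrow> ('a \<Rightarrow> ddf) set" where
  "Lip1_star K D star =
     {f \<in> extensional K. \<forall>x\<in>K. \<forall>y\<in>K. star (D x y) (f y) \<le> f x}"

lemma sup_dist_bdd_above: "bdd_above ((\<lambda>x. dist (f x) (g x :: ddf)) ` K)"
  by (rule bdd_aboveI[of _ 1]) (auto simp: dist_ddf_def levy_dist_le_1)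

lemma sup_dist_upper: "x \<in> K \<Longrightarrow> dist (f x) (g x) \<le> sup_dist K f g"
  by (auto simp: sup_dist_def intro!: cSUP_upper sup_dist_bdd_above)

lemma sup_dist_nonneg: "0 \<le> sup_dist K f g"
proof (cases "K = {}")
  case False
  then obtain x where "x \<in> K" by auto
  then show ?thesis
    using sup_dist_upper[of x K f g] zero_le_dist[of "f x" "g x"] by linarith
qed (simp add: sup_dist_def)

lemma sup_dist_commute: "sup_dist K f g = sup_dist K g f"
  by (simp add: sup_dist_def dist_commute)

lemma sup_dist_triangle: "sup_dist K f h \<le> sup_dist K f g + sup_dist K g h"
proof (cases "K = {}")
  case False
  have "dist (f x) (h x) \<le> sup_dist K f g + sup_dist K g h" if "x \<in> K" for x
    using dist_triangle[of "f x" "h x" "g x"] sup_dist_upper[OF that, of f g]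
      sup_dist_upper[OF that, of g h] by linarith
  then show ?thesis
    using False by (simp add: sup_dist_def[of K f h] cSUP_least)
qed (simp add: sup_dist_def)

lemma sup_dist_zero_iff: "sup_dist K f g = 0 \<longleftrightarrow> (\<forall>x\<in>K. f x = g x)"
proof
  assume "sup_dist K f g = 0"
  then show "\<forall>x\<in>K. f x = g x"
    using sup_dist_upper[of _ K f g] by (metis dist_le_zero_iff)
qed (simp add: sup_dist_def)

lemma Metric_space_sup_dist:
  assumes "M \<subseteq> extensional K"
  shows "Metric_space M (sup_dist K)"
proof
  fix f g assume "f \<in> M" "g \<in> M"
  then show "sup_dist K f g = 0 \<longleftrightarrow> f = g"
    using assms by (auto simp: sup_dist_zero_iff intro: extensionalityI)
qed (auto simp: sup_dist_nonneg sup_dist_commute sup_dist_triangle)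

lemma Metric_space_Lip1_star: "Metric_space (Lip1_star K D star) (sup_dist K)"
  by (rule Metric_space_sup_dist) (auto simp: Lip1_star_def)

lemma Metric_space_C_star: "Metric_space (C_star K D) (sup_dist K)"
  by (rule Metric_space_sup_dist) (auto simp: C_star_def)

lemma Metric_space_sigma_dist:
  assumes "prob_metric_space K D star"
  shows "Metric_space K (sigma_dist K D)"
proof
  fix x y assume xy: "x \<in> K" "y \<in> K"
  have "x = y" if eq: "\<forall>z\<in>K. D x z = D y z"
  proof -
    have D: "\<forall>x\<in>K. \<forall>y\<in>K. D x y = H0 \<longleftrightarrow> x = y"
      using assms by (simp add: prob_metric_space_def)
    have "D x y = D y y" using eq xy(2) by blast
    also have "D y y = H0" using D xy(2) by blast
    finally show ?thesis using D xy by blast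
  qed
  then show "sigma_dist K D x y = 0 \<longleftrightarrow> x = y"
    by (auto simp: sigma_dist_def sup_dist_zero_iff)
qed (simp_all add: sigma_dist_def sup_dist_nonneg sup_dist_commute sup_dist_triangle)

end

theory Submission
  imports Defs "HOL-Probability.Helly_Selection"
begin

text \<open>
  Helly's selection theorem makes the space of distance distribution functions compact, so a
  continuous triangle function is uniformly continuous; hence the probabilistic 1-Lipschitz maps
  are uniformly equicontinuous, and a finite cover of \<open>K\<close> by small neighbourhoods makes the space of
  such maps totally bounded.  It is complete because the order is closed.  Conversely
  \<open>x \<mapsto> D x\<close> embeds \<open>(K, \<sigma>\<^sub>D)\<close> isometrically into the space of 1-Lipschitz maps, and
  \<open>\<sigma>\<^sub>D x y\<close> dominates the distance of \<open>D x y\<close> to \<open>H0\<close>, so total boundedness passes back to \<open>K\<close>.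
\<close>

section \<open>Compactness of the space of distance distribution functions\<close>

lemma isCont_dfun_iff: "isCont (dfun F) (ereal t) \<longleftrightarrow> isCont (\<lambda>s. dfun F (ereal s)) t"
  unfolding isCont_def unfolding at_ereal filterlim_filtermap ..

lemma dfun_left_tendsto: "((\<lambda>s. dfun F (ereal s)) \<longlongrightarrow> dfun F (ereal t)) (at_left t)"
  using dfun_left_continuous[of t F]
  unfolding continuous_within unfolding at_left_ereal filterlim_filtermap .

text \<open>A monotone function has only countably many discontinuities, too few to fill an open
  interval.\<close>

lemma dfun_continuity_point_between:
  fixes a b :: real
  assumes "a < b"
  obtains c where "a < c" "c < b" "isCont (dfun F) (ereal c)"
proof -
  have "mono (\<lambda>s. dfun F (ereal s))"
    by (auto simp: mono_def intro: dfun_mono)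
  from open_minus_countable[OF mono_ctble_discont[OF this], of "{a<..<b}"] assms
  show ?thesis
    using that by (auto simp: isCont_dfun_iff)
qed

text \<open>Admissible numbers form an upward closed set, so everything strictly above the infimum
  is admissible. This turns metric bounds into pointwise inequalities.\<close>

lemma levy_adm_dist_less:
  assumes "dist F L < h"
  shows "levy_adm F L h"
  using assms levy_dist_less_iff[of F L h] levy_adm_mono[of F L _ h] by (auto simp: dist_ddf_def)

text \<open>Use scale \<open>t - s\<close> at the point \<open>s\<close> and let \<open>s\<close>
  increase to \<open>t\<close>: left continuity of \<open>F\<close> removes the error.\<close>

lemma ddf_le_approxI:
  assumes "\<And>h t. \<lbrakk>0 < h; 0 < t; t < inverse h\<rbrakk> \<Longrightarrow> dfun F (ereal t) \<le> dfun L (ereal (t + h)) + h"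
  shows "F \<le> L"
  unfolding less_eq_ddf_def
proof
  fix t :: real
  show "dfun F (ereal t) \<le> dfun L (ereal t)"
  proof (cases "t \<le> 0")
    case False
    then have t: "0 < t" by simp
    have ev: "\<forall>\<^sub>F s in at_left t. dfun F (ereal s) \<le> dfun L (ereal t) + (t - s)"
    proof (rule eventually_at_leftI)
      \<comment> \<open>The bound forces \<open>t - s < inverse t\<close>, hence
        \<open>s < t < inverse (t - s)\<close>, where the assumption applies.\<close>
      show "max 0 (t - inverse t) < t" using t by auto
      fix s assume s: "s \<in> {max 0 (t - inverse t)<..<t}"
      have "inverse (inverse t) < inverse (t - s)"
        using s by (intro less_imp_inverse_less) auto
      then show "dfun F (ereal s) \<le> dfun L (ereal t) + (t - s)"
        using assms[of "t - s" s] s by simp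
    qed
    have "((\<lambda>s. dfun L (ereal t) + (t - s)) \<longlongrightarrow> dfun L (ereal t) + (t - t)) (at_left t)"
      by (intro tendsto_intros)
    from tendsto_le[OF _ this dfun_left_tendsto ev] show ?thesis
      by simp
  qed (simp add: dfun_nonpos)
qed

lemma ddf_le_limit:
  fixes F L :: ddf
  assumes "Fs \<longlonglongrightarrow> F" "Ls \<longlonglongrightarrow> L" "\<And>n. Fs n \<le> Ls n"
  shows "F \<le> L"
proof (rule ddf_le_approxI)
  fix h t :: real assume h: "0 < h" "0 < t" "t < inverse h"
  \<comment> \<open>Two shifts by \<open>k\<close> must fit into \<open>h\<close>, and both
    \<open>t\<close> and \<open>t + k\<close> must stay below \<open>inverse k\<close>.\<close>
  define k where "k = min (h / 2) (inverse (t + h) / 2)"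
  have k: "0 < k" "k \<le> h / 2" "k < inverse (t + h)"
    using h by (auto simp: k_def min_less_iff_disj)
  have lt: "t + k < inverse k"
  proof -
    have "t + h < inverse k"
      using less_imp_inverse_less[OF k(3,1)] by simp
    then show ?thesis using k h by linarith
  qed
  have "\<forall>\<^sub>F n in sequentially. dist (Fs n) F < k \<and> dist (Ls n) L < k"
    using assms(1,2) k(1) by (auto intro!: eventually_conj tendstoD)
  then obtain n where n: "levy_adm (Fs n) F k" "levy_adm (Ls n) L k"
    by (auto simp: eventually_sequentially intro!: levy_adm_dist_less)
  have "dfun F (ereal t) \<le> dfun (Fs n) (ereal (t + k)) + k"
    using levy_admD(2)[OF n(1)] lt h k by simp
  also have "\<dots> \<le> dfun (Ls n) (ereal (t + k)) + k"
    using assms(3)[of n] by (simp add: less_eq_ddf_def)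
  also have "\<dots> \<le> dfun L (ereal (t + k + k)) + k + k"
    using levy_admD(3)[OF n(2), of "t + k"] lt h k by simp
  also have "\<dots> \<le> dfun L (ereal (t + h)) + h"
    using dfun_mono[of "ereal (t + k + k)" "ereal (t + h)" L] k by simp
  finally show "dfun F (ereal t) \<le> dfun L (ereal (t + h)) + h" .
qed

section \<open>Levy convergence is weak convergence\<close>

text \<open>Admissibility squeezes \<open>dfun (Fs n) t\<close> between
  \<open>dfun F (t - h) - h\<close> and \<open>dfun F (t + h) + h\<close>; continuity at
  \<open>t\<close> closes the gap.\<close>

lemma tendsto_imp_weak_conv_ddf:
  assumes "Fs \<longlonglongrightarrow> F"
  shows "weak_conv_ddf Fs F"
  unfolding weak_conv_ddf_def
proof (intro allI impI)
  fix t :: real assume cont: "isCont (dfun F) (ereal t)"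
  show "(\<lambda>n. dfun (Fs n) (ereal t)) \<longlonglongrightarrow> dfun F (ereal t)"
  proof (cases "t \<le> 0")
    case False
    then have t: "0 < t" by simp
    show ?thesis
    proof (rule tendstoI)
      fix e :: real assume e: "0 < e"
      from cont e obtain r where r: "0 < r"
        "\<And>s. dist s t < r \<Longrightarrow> dist (dfun F (ereal s)) (dfun F (ereal t)) < e / 2"
        unfolding isCont_dfun_iff continuous_at_eps_delta by (meson half_gt_zero)
      \<comment> \<open>The four entries keep \<open>t - h\<close> and \<open>t + h\<close> in the
        continuity window, bound the additive error, keep \<open>t - h\<close> positive, and give
        \<open>t < inverse h\<close>.\<close>
      define h where "h = Min {r / 2, e / 2, t / 2, inverse t / 2}"
      have h: "0 < h" "h < r" "h \<le> e / 2" "h < t" "h < inverse t"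
        using r(1) e t by (auto simp: h_def min_def)
      have lt: "t < inverse h"
        using less_imp_inverse_less[OF h(5,1)] by simp
      have "\<forall>\<^sub>F n in sequentially. dist (Fs n) F < h"
        using assms h(1) by (rule tendstoD)
      then show "\<forall>\<^sub>F n in sequentially. dist (dfun (Fs n) (ereal t)) (dfun F (ereal t)) < e"
      proof eventually_elim
        case (elim n)
        note adm = levy_admD(2,3)[OF levy_adm_dist_less[OF elim]]
        have "dfun F (ereal (t - h)) \<le> dfun (Fs n) (ereal t) + h"
          using adm(1)[of "t - h"] h lt by simp
        moreover have "dfun (Fs n) (ereal t) \<le> dfun F (ereal (t + h)) + h"
          using adm(2)[of t] t lt by simp
        moreover have "dist (dfun F (ereal (t - h))) (dfun F (ereal t)) < e / 2"
          "dist (dfun F (ereal (t + h))) (dfun F (ereal t)) < e / 2"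
          using r(2)[of "t - h"] r(2)[of "t + h"] h by (simp_all add: dist_real_def)
        ultimately show ?case
          using h(3) unfolding dist_real_def by linarith
      qed
    qed
  qed (simp add: dfun_nonpos)
qed

text \<open>Convergence at finitely many continuity points, spread finely over the bounded window
  \<open>[0, inverse h)\<close>, controls all of that window by monotonicity.\<close>

lemma weak_conv_ddf_imp_tendsto:
  assumes "weak_conv_ddf Fs F"
  shows "Fs \<longlonglongrightarrow> F"
proof (rule tendstoI)
  fix e :: real assume e: "0 < e"
  define h where "h = e / 2"
  have h: "0 < h" "h < e" using e by (auto simp: h_def)
  \<comment> \<open>One continuity point is chosen in each cell of a grid of mesh
    \<open>h / 2\<close>.\<close>
  have "\<exists>c. real k * (h / 2) < c \<and> c < real (Suc k) * (h / 2) \<and> isCont (dfun F) (ereal c)" for k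
    using h(1) dfun_continuity_point_between[of "real k * (h / 2)" "real (Suc k) * (h / 2)" F]
    by (metis half_gt_zero lessI mult_less_cancel_right_pos of_nat_less_iff)
  then obtain c where c: "\<And>k. real k * (h / 2) < c k" "\<And>k. c k < real (Suc k) * (h / 2)"
    "\<And>k. isCont (dfun F) (ereal (c k))"
    by metis
  define N where "N = nat \<lceil>inverse h / (h / 2)\<rceil>"
  have "\<forall>\<^sub>F n in sequentially. \<forall>k\<in>{..N}. dist (dfun (Fs n) (ereal (c k))) (dfun F (ereal (c k))) < h"
    using assms c(3) h(1) by (intro eventually_ball_finite) (auto simp: weak_conv_ddf_def intro: tendstoD)
  then show "\<forall>\<^sub>F n in sequentially. dist (Fs n) F < e"
  proof eventually_elim
    case (elim n)
    have "levy_adm (Fs n) F h"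
    proof (rule levy_admI[OF h(1)])
      fix t :: real assume t: "0 \<le> t" "t < inverse h"
      \<comment> \<open>Rounding up puts cell \<open>k\<close> to the right of \<open>t\<close> and,
        since the mesh is \<open>h / 2\<close>, its right end at most at \<open>t + h\<close>. Thus
        \<open>c k\<close> lies between \<open>t\<close> and \<open>t + h\<close>.\<close>
      define k where "k = nat \<lceil>t / (h / 2)\<rceil>"
      have "t / (h / 2) \<le> inverse h / (h / 2)"
        using t h by (intro divide_right_mono) auto
      then have "k \<in> {..N}"
        unfolding k_def N_def atMost_iff by (intro nat_mono ceiling_mono)
      with elim have close: "\<bar>dfun (Fs n) (ereal (c k)) - dfun F (ereal (c k))\<bar> < h"
        by (auto simp: dist_real_def)
      have "t / (h / 2) \<le> real k" "real k < t / (h / 2) + 1"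
        unfolding k_def using t(1) h(1) ceiling_correct[of "t / (h / 2)"]
        by (simp_all add: real_nat_ceiling_ge)
      then have "t \<le> real k * (h / 2)" "real (Suc k) * (h / 2) \<le> t + h"
        using h(1) by (simp_all add: field_simps)
      then have "t < c k" "c k < t + h"
        using c(1,2)[of k] by linarith+
      then have mono: "dfun G (ereal t) \<le> dfun G (ereal (c k))"
        "dfun G (ereal (c k)) \<le> dfun G (ereal (t + h))" for G
        by (auto intro: dfun_mono)
      show "dfun F (ereal t) \<le> dfun (Fs n) (ereal (t + h)) + h"
        using mono(1)[of F] mono(2)[of "Fs n"] close by linarith
      show "dfun (Fs n) (ereal t) \<le> dfun F (ereal (t + h)) + h"
        using mono(1)[of "Fs n"] mono(2)[of F] close by linarith
    qed
    then show ?case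
      using levy_dist_le h(2) by (fastforce simp: dist_ddf_def)
  qed
qed

lemma weak_conv_ddf_iff_tendsto: "weak_conv_ddf Fs F \<longleftrightarrow> Fs \<longlonglongrightarrow> F"
  using tendsto_imp_weak_conv_ddf weak_conv_ddf_imp_tendsto by blast

section \<open>Sequential compactness and Levy balls around \<open>H0\<close>\<close>

text \<open>The values at both infinities are prescribed. Left continuity is imposed at real points
  only, so the value 1 at infinity is consistent even when mass escapes there.\<close>

lemma ddf_of_real_function:
  fixes f :: "real \<Rightarrow> real"
  assumes "mono f" "\<And>t. 0 \<le> f t" "\<And>t. f t \<le> 1" "\<And>t. continuous (at_left t) f" "f 0 = 0"
  obtains F where "\<And>t. dfun F (ereal t) = f t"
proof
  define G :: "ereal \<Rightarrow> real" where
    "G s = (if s = \<infinity> then 1 else if s = -\<infinity> then 0 else f (real_of_ereal s))" for s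
  have G: "G (ereal t) = f t" "G \<infinity> = 1" "G (-\<infinity>) = 0" for t
    by (simp_all add: G_def)
  have "mono G"
  proof (rule monoI)
    fix s t :: ereal assume "s \<le> t"
    then show "G s \<le> G t"
      using assms(2,3) monoD[OF assms(1)] by (cases s; cases t) (auto simp: G)
  qed
  moreover have "G s \<in> {0..1}" for s
    using assms(2,3) by (cases s) (auto simp: G)
  moreover have "continuous (at_left (ereal t)) G" for t
    using assms(4)[of t] unfolding continuous_within
    unfolding at_left_ereal filterlim_filtermap G .
  moreover have "G 0 = 0"
    using G(1)[of 0] assms(5) by (simp add: zero_ereal_def)
  ultimately have "dfun (Abs_ddf G) = G"
    using G by (intro Abs_ddf_inverse) auto
  then show "dfun (Abs_ddf G) (ereal t) = f t" for t
    by (simp add: G)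
qed

text \<open>Helly's theorem is about right-continuous functions, so it is applied to \<open>s \<mapsto> - F (- s)\<close>.\<close>

lemma ddf_seq_compact:
  fixes Fs :: "nat \<Rightarrow> ddf"
  obtains r F where "strict_mono (r :: nat \<Rightarrow> nat)" "(Fs \<circ> r) \<longlonglongrightarrow> F"
proof -
  define f where "f n s = - dfun (Fs n) (ereal (- s))" for n and s :: real
  have "\<exists>r. strict_mono (r :: nat \<Rightarrow> nat) \<and> (\<exists>g. (\<forall>x. continuous (at_right x) g) \<and> mono g \<and>
    (\<forall>x. \<bar>g x\<bar> \<le> 1) \<and> (\<forall>x. isCont g x \<longrightarrow> (\<lambda>n. f (r n) x) \<longlonglongrightarrow> g x))"
  proof (rule Helly_selection)
    show "continuous (at_right x) (f n)" for n x
      using tendsto_minus[OF dfun_left_tendsto[of "Fs n" "- x"]]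
      unfolding continuous_within filterlim_at_left_to_right f_def by simp
    show "mono (f n)" for n
      by (auto simp: mono_def f_def intro: dfun_mono)
    show "\<bar>f n x\<bar> \<le> 1" for n x
      by (simp add: f_def dfun_bounds)
  qed
  then obtain r g where r: "strict_mono (r :: nat \<Rightarrow> nat)"
    and g: "\<And>x. continuous (at_right x) g" "mono g" "\<And>x. \<bar>g x\<bar> \<le> 1"
      "\<And>x. isCont g x \<Longrightarrow> (\<lambda>n. f (r n) x) \<longlonglongrightarrow> g x"
    by blast
  \<comment> \<open>Undoing the reflection turns right continuity of \<open>g\<close> into left
    continuity of \<open>G\<close>.\<close>
  define G where "G t = - g (- t)" for t
  have lcont: "continuous (at_left t) G" for t
    using tendsto_minus[of g "g (- t)" "at_right (- t)"] g(1)[of "- t"]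
    by (simp add: continuous_within G_def filterlim_at_left_to_right)
  have mono: "mono G"
    using g(2) by (auto simp: mono_def G_def)
  have lim: "(\<lambda>n. dfun (Fs (r n)) (ereal t)) \<longlonglongrightarrow> G t" if "isCont G t" for t
  proof -
    have "isCont (\<lambda>s. G (- s)) (- t)"
      by (rule isCont_o2[where f = "\<lambda>s. - s" and g = G]) (simp_all add: that)
    then have "isCont (\<lambda>s. - G (- s)) (- t)"
      by (rule isCont_minus)
    then have "isCont g (- t)" unfolding G_def by simp
    from tendsto_minus[OF g(4)[OF this]] show ?thesis
      unfolding f_def G_def by simp
  qed
  have between: "\<exists>c. a < c \<and> c < b \<and> isCont G c" if "a < b" for a b
    using open_minus_countable[OF mono_ctble_discont[OF mono], of "{a<..<b}"] that by auto
  \<comment> \<open>Limits are known only at continuity points, so the bound is taken at one to the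
    left of \<open>t\<close> and carried over by monotonicity.\<close>
  have nonneg: "0 \<le> G t" for t
  proof -
    obtain c where c: "c < t" "isCont G c" using between[of "t - 1" t] by auto
    have "0 \<le> G c"
      by (rule LIMSEQ_le_const[OF lim[OF c(2)]]) (simp add: dfun_bounds)
    also have "\<dots> \<le> G t" using monoD[OF mono] c by simp
    finally show ?thesis .
  qed
  have "G s = 0" if neg: "s < 0" for s
  proof -
    obtain c where c: "s < c" "c < 0" "isCont G c" using between[of s 0] neg by auto
    have "G c = 0"
      using lim[OF c(3)] c(2) by (simp add: dfun_nonpos LIMSEQ_const_iff)
    then show ?thesis
      using monoD[OF mono, of s c] nonneg[of s] c by simp
  qed
  \<comment> \<open>Convergence at 0 itself is not yet known; left continuity transports the zero
    values to it.\<close>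
  then have "\<forall>\<^sub>F s in at_left 0. G s = 0"
    by (simp add: eventually_at_filter)
  then have "(G \<longlongrightarrow> 0) (at_left 0)"
    by (rule tendsto_eventually)
  then have "G 0 = 0"
    using lcont[of 0] tendsto_unique[of "at_left (0::real)" G] by (auto simp: continuous_within)
  moreover have "G t \<le> 1" for t
    using g(3)[of "- t"] by (simp add: G_def)
  ultimately obtain F where F: "\<And>t. dfun F (ereal t) = G t"
    using ddf_of_real_function mono nonneg lcont by metis
  have "weak_conv_ddf (Fs \<circ> r) F"
    unfolding weak_conv_ddf_def isCont_dfun_iff F using lim by simp
  then show ?thesis
    using that r weak_conv_ddf_imp_tendsto by blast
qed

lemma compact_UNIV_ddf: "compact (UNIV :: ddf set)"
  unfolding compact_eq_seq_compact_metric seq_compact_def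
  using ddf_seq_compact by (metis UNIV_I)

lemma ddf_finite_net:
  assumes "0 < e"
  obtains B :: "ddf set" where "finite B" "\<And>F. \<exists>b\<in>B. dist b F < e"
  using seq_compact_imp_totally_bounded[of "UNIV :: ddf set"] compact_UNIV_ddf assms
  unfolding compact_eq_seq_compact_metric by (metis UNIV_I UN_iff mem_ball subset_iff)

text \<open>As \<open>H0\<close> is 1 on the positive reals, admissibility against it bounds
  \<open>F\<close> from below just to the right of \<open>h\<close>. This identifies
  \<open>prob_nbhd\<close> with conditions on the distance to \<open>H0\<close>.\<close>

lemma dist_H0_less_iff:
  assumes "0 < t"
  shows "dist F H0 < t \<longleftrightarrow> 1 - t < dfun F (ereal t)"
proof
  assume "dist F H0 < t"
  then obtain h where h: "h < t" "levy_adm F H0 h"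
    by (auto simp: dist_ddf_def levy_dist_less_iff)
  have pos: "0 < h" using h(2) by (rule levy_admD)
  \<comment> \<open>The point must be positive for \<open>H0\<close> to be 1 there, inside the
    admissible window, and with \<open>u + h\<close> at most \<open>t\<close>.\<close>
  define u where "u = min (t - h) (inverse h / 2)"
  have u: "0 < u" "u < inverse h" "u + h \<le> t"
    using h(1) pos by (auto simp: u_def min_def field_simps)
  have "1 \<le> dfun F (ereal (u + h)) + h"
    using levy_admD(2)[OF h(2), of u] u by (simp add: dfun_H0)
  also have "\<dots> \<le> dfun F (ereal t) + h"
    using dfun_mono[of "ereal (u + h)" "ereal t" F] u by simp
  finally show "1 - t < dfun F (ereal t)"
    using h(1) by linarith
next
  assume *: "1 - t < dfun F (ereal t)"
  \<comment> \<open>Left continuity preserves the strict inequality at some \<open>s < t\<close>;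
    that \<open>s\<close> is admissible, so the distance is strictly below \<open>t\<close>.\<close>
  have "((\<lambda>s. dfun F (ereal s) + s) \<longlongrightarrow> dfun F (ereal t) + t) (at_left t)"
    by (intro tendsto_intros dfun_left_tendsto)
  moreover have "1 < dfun F (ereal t) + t" using * by simp
  ultimately have "\<forall>\<^sub>F s in at_left t. 1 < dfun F (ereal s) + s"
    by (rule order_tendstoD)
  moreover have "\<forall>\<^sub>F s in at_left t. s \<in> {0<..<t}"
    using assms by (intro eventually_at_leftI[of 0]) auto
  ultimately have "\<forall>\<^sub>F s in at_left t. 1 < dfun F (ereal s) + s \<and> s \<in> {0<..<t}"
    by (rule eventually_conj)
  then obtain s where s: "1 < dfun F (ereal s) + s" "0 < s" "s < t"
    using eventually_happens'[of "at_left t"] by auto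
  have "levy_adm F H0 s"
  proof (rule levy_admI[OF s(2)])
    fix u :: real assume u: "0 \<le> u"
    show "dfun H0 (ereal u) \<le> dfun F (ereal (u + s)) + s"
      using s(1) dfun_bounds(2)[of H0 "ereal u"] dfun_mono[of "ereal s" "ereal (u + s)" F] u
      by simp
    show "dfun F (ereal u) \<le> dfun H0 (ereal (u + s)) + s"
      using u s(2) dfun_bounds(2)[of F "ereal u"] by (simp add: dfun_H0)
  qed
  then show "dist F H0 < t"
    using s(3) by (auto simp: dist_ddf_def levy_dist_less_iff)
qed

section \<open>Continuous triangle functions\<close>

lemma tendsto_triangle_function:
  assumes "continuous_triangle_function star" "Fs \<longlonglongrightarrow> F" "Ls \<longlonglongrightarrow> L"
  shows "(\<lambda>n. star (Fs n) (Ls n)) \<longlonglongrightarrow> star F L"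
  using assms by (simp add: continuous_triangle_function_def weak_conv_ddf_iff_tendsto)

text \<open>Heine-Cantor on the compact square of the space of distribution functions.\<close>

lemma uniformly_continuous_triangle_function:
  assumes "continuous_triangle_function star"
  shows "uniformly_continuous_on UNIV (\<lambda>(F, L). star F L)"
proof (rule compact_uniformly_continuous)
  show "continuous_on UNIV (\<lambda>(F, L). star F L)"
    unfolding continuous_on_sequentially
    by (auto simp: comp_def case_prod_beta intro!: tendsto_triangle_function[OF assms]
        dest: tendsto_fst tendsto_snd)
  show "compact (UNIV :: (ddf \<times> ddf) set)"
    using compact_Times[OF compact_UNIV_ddf compact_UNIV_ddf] by simp
qed

text \<open>Both \<open>F\<close> and \<open>L\<close> are uniformly close to \<open>star G F\<close> and \<open>star G L\<close> because \<open>G\<close> is close to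
  the unit; the two inequalities then sandwich \<open>F\<close> and \<open>L\<close>.\<close>

lemma triangle_function_equicontinuous:
  assumes star: "continuous_triangle_function star" and e: "0 < e"
  obtains d where "0 < d"
    "\<And>F L G. \<lbrakk>dist G H0 < d; star G F \<le> L; star G L \<le> F\<rbrakk> \<Longrightarrow> dist F L < e"
proof -
  define h where "h = e / 2"
  have h: "0 < h" "h < e" using e by (auto simp: h_def)
  obtain d where d: "0 < d" and unif: "\<And>p q. dist q p < d \<Longrightarrow>
      dist (case q of (F, L) \<Rightarrow> star F L) (case p of (F, L) \<Rightarrow> star F L) < h"
    using uniformly_continuous_triangle_function[OF star] h(1)
    unfolding uniformly_continuous_on_def by (metis UNIV_I)
  show ?thesis
  proof
    show "0 < d" by fact
    fix F L G assume G: "dist G H0 < d" "star G F \<le> L" "star G L \<le> F"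
    \<comment> \<open>Comparing \<open>(G, M)\<close> with \<open>(H0, M)\<close>, where
      \<open>star H0 M = M\<close>, makes the estimate uniform in \<open>M\<close>.\<close>
    have "dist (star G M) M < h" for M
      using unif[of "(G, M)" "(H0, M)"] G(1) star
      by (simp add: dist_Pair_Pair continuous_triangle_function_def triangle_function_def)
    then have adm: "levy_adm (star G M) M h" for M
      by (rule levy_adm_dist_less)
    have "levy_adm F L h"
    proof (rule levy_admI[OF h(1)])
      fix t :: real assume t: "0 \<le> t" "t < inverse h"
      show "dfun L (ereal t) \<le> dfun F (ereal (t + h)) + h"
        using levy_admD(2)[OF adm t, of L] G(3) by (meson add_right_mono less_eq_ddf_def order_trans)
      show "dfun F (ereal t) \<le> dfun L (ereal (t + h)) + h"
        using levy_admD(2)[OF adm t, of F] G(2) by (meson add_right_mono less_eq_ddf_def order_trans)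
    qed
    then show "dist F L < e"
      using levy_dist_le h(2) by (fastforce simp: dist_ddf_def)
  qed
qed

section \<open>Spaces of functions on a probabilistic metric space\<close>

lemma sup_dist_le:
  assumes "0 \<le> e" "\<And>x. x \<in> K \<Longrightarrow> dist (f x) (g x) \<le> e"
  shows "sup_dist K f g \<le> e"
  using assms by (auto simp: sup_dist_def intro: cSUP_least)

text \<open>By symmetry of \<open>D\<close>, the Lipschitz inequality for \<open>(x, y)\<close> and
  \<open>(y, x)\<close> gives both sandwich hypotheses with \<open>G = D x y\<close>; the resulting
  \<open>d\<close> is independent of \<open>f\<close>.\<close>

lemma Lip1_star_uniformly_equicontinuous:
  assumes "prob_metric_space K D star" "continuous_triangle_function star" "0 < e"
  obtains d where "0 < d"
    "\<And>f x y. \<lbrakk>f \<in> Lip1_star K D star; x \<in> K; y \<in> K; dist (D x y) H0 < d\<rbrakk> \<Longrightarrow> dist (f x) (f y) < e"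
proof -
  from triangle_function_equicontinuous[OF assms(2,3)] obtain d where d: "0 < d"
    "\<And>F L G. \<lbrakk>dist G H0 < d; star G F \<le> L; star G L \<le> F\<rbrakk> \<Longrightarrow> dist F L < e"
    by blast
  show ?thesis
  proof (rule that[OF d(1)])
    fix f x y assume "f \<in> Lip1_star K D star" and xy: "x \<in> K" "y \<in> K" "dist (D x y) H0 < d"
    then have "star (D x y) (f y) \<le> f x" "star (D y x) (f x) \<le> f y"
      by (auto simp: Lip1_star_def)
    moreover have "D y x = D x y"
      using assms(1) xy by (simp add: prob_metric_space_def)
    ultimately show "dist (f x) (f y) < e"
      using d(2)[OF xy(3)] by simp
  qed
qed

text \<open>This is the triangle inequality with one endpoint fixed at \<open>x\<close>, rearranged
  by symmetry.\<close>

lemma restrict_D_in_Lip1_star: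
  assumes "prob_metric_space K D star" "x \<in> K"
  shows "restrict (D x) K \<in> Lip1_star K D star"
proof -
  have "star (D y z) (D x z) \<le> D x y" if "y \<in> K" "z \<in> K" for y z
  proof -
    have "star (D y z) (D z x) \<le> D y x"
      using assms that unfolding prob_metric_space_def by blast
    then show ?thesis
      using assms that unfolding prob_metric_space_def by metis
  qed
  then show ?thesis
    by (simp add: Lip1_star_def)
qed

text \<open>Test the supremum at \<open>y\<close>, where \<open>D y y = H0\<close>.\<close>

lemma dist_H0_le_sup_dist:
  assumes "prob_metric_space K D star" "x \<in> K" "y \<in> K"
  shows "dist (D x y) H0 \<le> sup_dist K (D x) (D y)"
proof -
  have "D y y = H0"
    using assms unfolding prob_metric_space_def by blast
  then show ?thesis
    using sup_dist_upper[of y K "D x" "D y"] assms(3) by simp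
qed

text \<open>The maps \<open>D z\<close> are 1-Lipschitz, so one modulus of equicontinuity serves
  every \<open>z\<close> in the supremum defining \<open>sigma_dist\<close>.\<close>

lemma sigma_dist_uniform_estimate:
  assumes "prob_metric_space K D star" "continuous_triangle_function star" "0 < e"
  obtains d where "0 < d"
    "\<And>x y. \<lbrakk>x \<in> K; y \<in> K; dist (D x y) H0 < d\<rbrakk> \<Longrightarrow> sigma_dist K D x y < e"
proof -
  obtain d where d: "0 < d"
    "\<And>f x y. \<lbrakk>f \<in> Lip1_star K D star; x \<in> K; y \<in> K; dist (D x y) H0 < d\<rbrakk> \<Longrightarrow> dist (f x) (f y) < e / 2"
    using Lip1_star_uniformly_equicontinuous[OF assms(1,2), of "e / 2"] assms(3) by auto
  show ?thesis
  proof (rule that[OF d(1)])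
    fix x y assume xy: "x \<in> K" "y \<in> K" "dist (D x y) H0 < d"
    have "dist (D x z) (D y z) \<le> e / 2" if z: "z \<in> K" for z
    proof -
      have "D x z = D z x" "D y z = D z y"
        using assms(1) xy z by (auto simp: prob_metric_space_def)
      then show ?thesis
        using d(2)[OF restrict_D_in_Lip1_star[OF assms(1) z] xy] xy by simp
    qed
    then have "sup_dist K (D x) (D y) \<le> e / 2"
      using assms(3) by (intro sup_dist_le) auto
    then show "sigma_dist K D x y < e"
      using assms(3) by (simp add: sigma_dist_def)
  qed
qed

section \<open>The two descriptions of continuous maps\<close>

text \<open>Convergence of \<open>D (zs n) z\<close> to \<open>H0\<close> is convergence for
  \<open>sigma_dist\<close>: the uniform estimate gives one direction, domination by
  \<open>sigma_dist\<close> the other. In a metric space, sequential continuity is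
  continuity.\<close>

lemma C_star_eq_C_sigma:
  assumes pms: "prob_metric_space K D star" and star: "continuous_triangle_function star"
  shows "C_star K D = C_sigma K D"
proof -
  interpret sigma: Metric_space K "sigma_dist K D"
    using pms by (rule Metric_space_sigma_dist)
  have lim_iff: "(\<lambda>n. dist (D (zs n) z) H0) \<longlonglongrightarrow> 0 \<longleftrightarrow> limitin sigma.mtopology zs z sequentially"
    if "z \<in> K" "range zs \<subseteq> K" for z and zs :: "nat \<Rightarrow> _"
  proof -
    have zs: "zs n \<in> K" for n using that(2) by auto
    show ?thesis
    proof
      assume L: "(\<lambda>n. dist (D (zs n) z) H0) \<longlonglongrightarrow> 0"
      show "limitin sigma.mtopology zs z sequentially"
        unfolding sigma.limitin_metric
      proof (intro conjI allI impI)
        fix e :: real assume "0 < e"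
        then obtain d where d: "0 < d"
          "\<And>x y. \<lbrakk>x \<in> K; y \<in> K; dist (D x y) H0 < d\<rbrakk> \<Longrightarrow> sigma_dist K D x y < e"
          using sigma_dist_uniform_estimate[OF pms star] by blast
        have "\<forall>\<^sub>F n in sequentially. dist (D (zs n) z) H0 < d"
          using order_tendstoD(2)[OF L d(1)] .
        then show "\<forall>\<^sub>F n in sequentially. zs n \<in> K \<and> sigma_dist K D (zs n) z < e"
          by eventually_elim (use d(2) zs that(1) in auto)
      qed (fact that)
    next
      assume "limitin sigma.mtopology zs z sequentially"
      then have "(\<lambda>n. sigma_dist K D (zs n) z) \<longlonglongrightarrow> 0"
        by (simp add: sigma.limitin_metric_dist_null)
      then show "(\<lambda>n. dist (D (zs n) z) H0) \<longlonglongrightarrow> 0"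
        by (rule metric_tendsto_imp_tendsto)
          (use dist_H0_le_sup_dist[OF pms zs that(1)] in
            \<open>auto simp: sigma_dist_def dist_real_def
              intro!: always_eventually order_trans[OF _ abs_ge_self]\<close>)
    qed
  qed
  have "(\<forall>z\<in>K. \<forall>zs. range zs \<subseteq> K \<longrightarrow> (\<lambda>n. dist (D (zs n) z) H0) \<longlonglongrightarrow> 0 \<longrightarrow>
          (\<lambda>n. dist (f (zs n)) (f z)) \<longlonglongrightarrow> 0) \<longleftrightarrow> continuous_map sigma.mtopology euclidean f"
    (is "?L \<longleftrightarrow> ?R") for f :: "_ \<Rightarrow> ddf"
  proof
    assume ?R
    show ?L
    proof (intro ballI allI impI)
      fix z zs assume z: "z \<in> K" "range zs \<subseteq> K" "(\<lambda>n. dist (D (zs n) z) H0) \<longlonglongrightarrow> 0"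
      then have "limitin sigma.mtopology zs z sequentially"
        by (simp add: lim_iff)
      from continuous_map_limit[OF \<open>?R\<close> this] have "(f \<circ> zs) \<longlonglongrightarrow> f z" by simp
      then show "(\<lambda>n. dist (f (zs n)) (f z)) \<longlonglongrightarrow> 0"
        by (simp add: tendsto_dist_iff[symmetric] comp_def)
    qed
  next
    assume ?L
    show ?R
      \<comment> \<open>Preimages of closed sets are shown to be sequentially closed, which suffices
        in a metric space.\<close>
      unfolding continuous_map_closedin
    proof (intro conjI allI impI)
      fix C :: "ddf set" assume "closedin euclidean C"
      then have C: "closed C" by simp
      show "closedin sigma.mtopology {x \<in> topspace sigma.mtopology. f x \<in> C}"
        unfolding sigma.metric_closedin_iff_sequentially_closed
      proof (intro conjI allI impI)
        fix zs z assume *: "range zs \<subseteq> {x \<in> topspace sigma.mtopology. f x \<in> C} \<and>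
          limitin sigma.mtopology zs z sequentially"
        then have z: "z \<in> K" "range zs \<subseteq> K" "\<And>n. f (zs n) \<in> C"
          by (auto dest: sigma.limitin_mspace)
        with * have "(\<lambda>n. dist (D (zs n) z) H0) \<longlonglongrightarrow> 0"
          by (simp add: lim_iff)
        with \<open>?L\<close> z have "(\<lambda>n. dist (f (zs n)) (f z)) \<longlonglongrightarrow> 0" by blast
        then have "(\<lambda>n. f (zs n)) \<longlonglongrightarrow> f z"
          by (simp add: tendsto_dist_iff[symmetric])
        then have "f z \<in> C"
          by (rule closed_sequentially[OF C z(3)])
        then show "z \<in> {x \<in> topspace sigma.mtopology. f x \<in> C}"
          using z by simp
      qed auto
    qed auto
  qed
  then show ?thesis
    by (simp add: C_star_def C_sigma_def)
qed

lemma Lip1_star_subset_C_star: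
  assumes pms: "prob_metric_space K D star" and star: "continuous_triangle_function star"
  shows "Lip1_star K D star \<subseteq> C_star K D"
proof
  fix f assume f: "f \<in> Lip1_star K D star"
  have "(\<lambda>n. dist (f (zs n)) (f z)) \<longlonglongrightarrow> 0"
    if z: "z \<in> K" "range zs \<subseteq> K" and L: "(\<lambda>n. dist (D (zs n) z) H0) \<longlonglongrightarrow> 0" for z zs
  proof (rule tendstoI)
    fix e :: real assume "0 < e"
    then obtain d where d: "0 < d"
      "\<And>f x y. \<lbrakk>f \<in> Lip1_star K D star; x \<in> K; y \<in> K; dist (D x y) H0 < d\<rbrakk> \<Longrightarrow> dist (f x) (f y) < e"
      using Lip1_star_uniformly_equicontinuous[OF pms star] by blast
    have "\<forall>\<^sub>F n in sequentially. dist (D (zs n) z) H0 < d"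
      using order_tendstoD(2)[OF L d(1)] .
    then show "\<forall>\<^sub>F n in sequentially. dist (dist (f (zs n)) (f z)) 0 < e"
      by eventually_elim (use d(2)[OF f _ z(1)] z(2) in auto)
  qed
  then show "f \<in> C_star K D"
    using f by (simp add: C_star_def Lip1_star_def)
qed

section \<open>Completeness and total boundedness of the 1-Lipschitz maps\<close>

text \<open>Pointwise limits exist because a compact metric space is complete. Continuity of
  \<open>star\<close> and closedness of the order keep the limit 1-Lipschitz.\<close>

lemma Lip1_star_mcomplete:
  assumes star: "continuous_triangle_function star"
  shows "Metric_space.mcomplete (Lip1_star K D star) (sup_dist K)"
proof -
  interpret lip: Metric_space "Lip1_star K D star" "sup_dist K"
    by (rule Metric_space_Lip1_star)
  show ?thesis
    unfolding lip.mcomplete_def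
  proof (intro allI impI)
    fix fs assume Cauchy: "lip.MCauchy fs"
    then have fs: "fs n \<in> Lip1_star K D star" for n
      by (auto simp: lip.MCauchy_def)
    have Cau: "\<exists>N. \<forall>m\<ge>N. \<forall>n\<ge>N. sup_dist K (fs m) (fs n) < e" if "0 < e" for e
      using Cauchy that unfolding lip.MCauchy_def by meson
    have "\<exists>l. (\<lambda>n. fs n x) \<longlonglongrightarrow> l" if x: "x \<in> K" for x
    proof -
      have "Cauchy (\<lambda>n. fs n x)"
        unfolding Cauchy_def using Cau sup_dist_upper[OF x] by (meson le_less_trans)
      then show ?thesis
        using compact_imp_complete[OF compact_UNIV_ddf] unfolding complete_def by blast
    qed
    then obtain g where g: "\<And>x. x \<in> K \<Longrightarrow> (\<lambda>n. fs n x) \<longlonglongrightarrow> g x"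
      by metis
    define f where "f = restrict g K"
    have "f \<in> Lip1_star K D star"
      unfolding Lip1_star_def
    proof (safe)
      show "f \<in> extensional K" by (simp add: f_def)
      fix x y assume xy: "x \<in> K" "y \<in> K"
      have "star (D x y) (g y) \<le> g x"
      proof (rule ddf_le_limit)
        show "(\<lambda>n. star (D x y) (fs n y)) \<longlonglongrightarrow> star (D x y) (g y)"
          by (intro tendsto_triangle_function[OF star] tendsto_const g xy)
        show "(\<lambda>n. fs n x) \<longlonglongrightarrow> g x" by (rule g) fact
        show "star (D x y) (fs n y) \<le> fs n x" for n
          using fs xy by (simp add: Lip1_star_def)
      qed
      then show "star (D x y) (f y) \<le> f x"
        by (simp add: f_def xy)
    qed
    moreover have "\<forall>\<^sub>F n in sequentially. fs n \<in> Lip1_star K D star \<and> sup_dist K (fs n) f < e"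
      if e: "0 < e" for e
    proof -
      obtain N where N: "\<And>m n. \<lbrakk>N \<le> m; N \<le> n\<rbrakk> \<Longrightarrow> sup_dist K (fs m) (fs n) < e / 2"
        using Cau[of "e / 2"] e by auto
      have "sup_dist K (fs n) f < e" if n: "N \<le> n" for n
      proof -
        \<comment> \<open>Letting \<open>m\<close> tend to infinity in the Cauchy estimate gives a
          bound independent of \<open>x\<close>.\<close>
        have "dist (fs n x) (f x) \<le> e / 2" if x: "x \<in> K" for x
        proof (rule LIMSEQ_le_const2)
          show "(\<lambda>m. dist (fs n x) (fs m x)) \<longlonglongrightarrow> dist (fs n x) (f x)"
            using g[OF x] x by (simp add: f_def tendsto_dist)
          have "dist (fs n x) (fs m x) \<le> e / 2" if "N \<le> m" for m
            using N[OF n that] sup_dist_upper[OF x, of "fs n" "fs m"] by linarith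
          then show "\<exists>M. \<forall>m\<ge>M. dist (fs n x) (fs m x) \<le> e / 2" by blast
        qed
        then have "sup_dist K (fs n) f \<le> e / 2"
          using e by (intro sup_dist_le) auto
        then show ?thesis using e by simp
      qed
      then show ?thesis
        using fs by (auto simp: eventually_sequentially)
    qed
    ultimately show "\<exists>f. limitin lip.mtopology fs f sequentially"
      unfolding lip.limitin_metric by blast
  qed
qed

text \<open>As in the Arzela--Ascoli theorem, an equicontinuous function is determined up to a small error
  by its values, rounded to a finite net of distribution functions, on a finite net of points.\<close>

lemma Lip1_star_mtotally_bounded:
  assumes pms: "prob_metric_space K D star" and star: "continuous_triangle_function star"
    and cover: "\<And>t. 0 < t \<Longrightarrow> \<exists>A. finite A \<and> A \<subseteq> K \<and> K \<subseteq> (\<Union>x\<in>A. prob_nbhd K D x t)"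
  shows "Metric_space.mtotally_bounded (Lip1_star K D star) (sup_dist K) (Lip1_star K D star)"
proof -
  interpret lip: Metric_space "Lip1_star K D star" "sup_dist K"
    by (rule Metric_space_Lip1_star)
  show ?thesis
    unfolding lip.mtotally_bounded_def
  proof (intro allI impI)
    fix e :: real assume e: "0 < e"
    \<comment> \<open>The path \<open>g x\<close>, \<open>g a\<close>,
      \<open>b (g a) = b (f a)\<close>, \<open>f a\<close>, \<open>f x\<close> has four legs shorter
      than \<open>h\<close>; the fifth share makes the supremum strictly less than
      \<open>e\<close>.\<close>
    define h where "h = e / 5"
    have h: "0 < h" using e by (simp add: h_def)
    obtain d where d: "0 < d"
      "\<And>f x y. \<lbrakk>f \<in> Lip1_star K D star; x \<in> K; y \<in> K; dist (D x y) H0 < d\<rbrakk> \<Longrightarrow> dist (f x) (f y) < h"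
      using Lip1_star_uniformly_equicontinuous[OF pms star h] by blast
    obtain A where A: "finite A" "A \<subseteq> K" "K \<subseteq> (\<Union>x\<in>A. prob_nbhd K D x d)"
      using cover[OF d(1)] by blast
    obtain B :: "ddf set" where B: "finite B" "\<And>F. \<exists>b\<in>B. dist b F < h"
      using ddf_finite_net[OF h] by blast
    obtain b where b: "\<And>F. b F \<in> B" "\<And>F. dist (b F) F < h"
      using B(2) by metis
    define p where "p f = restrict (\<lambda>a. b (f a)) A" for f :: "'a \<Rightarrow> ddf"
    have "p ` Lip1_star K D star \<subseteq> A \<rightarrow>\<^sub>E B"
      by (auto simp: p_def b(1))
    then have "finite (p ` Lip1_star K D star)"
      using finite_PiE[OF A(1) B(1)] finite_subset by blast
    \<comment> \<open>Representatives of the finitely many rounded value patterns are chosen among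
      the 1-Lipschitz maps, so they can serve as centres of balls.\<close>
    then obtain S where S: "S \<subseteq> Lip1_star K D star" "finite S" "p ` S = p ` Lip1_star K D star"
      by (metis finite_subset_image order_refl)
    have "\<exists>g\<in>S. f \<in> lip.mball g e" if f: "f \<in> Lip1_star K D star" for f
    proof -
      obtain g where g: "g \<in> S" "p f = p g" using S(3) f by (metis image_iff)
      then have gL: "g \<in> Lip1_star K D star" using S(1) by auto
      have "dist (g x) (f x) \<le> 4 * h" if x: "x \<in> K" for x
      proof -
        obtain a where a: "a \<in> A" "x \<in> prob_nbhd K D a d" using A(3) x by auto
        have aK: "a \<in> K" using a A(2) by auto
        have near: "dist (D a x) H0 < d"
          using a(2) by (simp add: prob_nbhd_def dist_H0_less_iff[OF d(1)])
        have "b (f a) = b (g a)"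
          using g(2) a(1) by (metis p_def restrict_apply')
        then have "dist (b (g a)) (f a) < h"
          using b(2)[of "f a"] by simp
        then show ?thesis
          using d(2)[OF f aK x near] d(2)[OF gL aK x near] b(2)[of "g a"]
            dist_triangle2[of "g x" "f x" "f a"] dist_triangle2[of "g x" "f a" "g a"]
            dist_triangle3[of "g a" "f a" "b (g a)"]
          by (simp add: dist_commute)
      qed
      then have "sup_dist K g f \<le> 4 * h"
        using h by (intro sup_dist_le) auto
      then have "sup_dist K g f < e"
        using e by (simp add: h_def)
      then show ?thesis
        using g(1) gL f by auto
    qed
    then show "\<exists>S. finite S \<and> S \<subseteq> Lip1_star K D star \<and>
        Lip1_star K D star \<subseteq> (\<Union>g\<in>S. lip.mball g e)"
      using S(1,2) by (intro exI[of _ S]) auto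
  qed
qed

section \<open>Back to \<open>K\<close>, and the equivalence\<close>

lemma finite_cover_of_mtotally_bounded_Lip1_star:
  assumes pms: "prob_metric_space K D star"
    and tb: "Metric_space.mtotally_bounded (Lip1_star K D star) (sup_dist K) (Lip1_star K D star)"
    and t: "0 < t"
  shows "\<exists>A. finite A \<and> A \<subseteq> K \<and> K \<subseteq> (\<Union>x\<in>A. prob_nbhd K D x t)"
proof -
  interpret lip: Metric_space "Lip1_star K D star" "sup_dist K"
    by (rule Metric_space_Lip1_star)
  let ?\<delta> = "\<lambda>x. restrict (D x) K"
  have "?\<delta> ` K \<subseteq> Lip1_star K D star"
    using restrict_D_in_Lip1_star[OF pms] by blast
  \<comment> \<open>Total boundedness of the image itself provides centres inside it, hence centres
    coming from points of \<open>K\<close>.\<close>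
  then have "lip.mtotally_bounded (?\<delta> ` K)"
    using tb lip.mtotally_bounded_subset by blast
  then obtain S where S: "finite S" "S \<subseteq> ?\<delta> ` K" "?\<delta> ` K \<subseteq> (\<Union>g\<in>S. lip.mball g t)"
    using t unfolding lip.mtotally_bounded_def by meson
  obtain A where A: "A \<subseteq> K" "finite A" "S = ?\<delta> ` A"
    using finite_subset_image[OF S(1,2)] by blast
  have "\<exists>a\<in>A. x \<in> prob_nbhd K D a t" if x: "x \<in> K" for x
  proof -
    have "?\<delta> x \<in> (\<Union>g\<in>S. lip.mball g t)"
      using S(3) x by blast
    then obtain a where a: "a \<in> A" "sup_dist K (?\<delta> a) (?\<delta> x) < t"
      using A(3) by auto
    have "sup_dist K (?\<delta> a) (?\<delta> x) = sup_dist K (D a) (D x)"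
      by (auto simp: sup_dist_def intro: SUP_cong)
    then have "dist (D a x) H0 < t"
      using dist_H0_le_sup_dist[OF pms _ x, of a] a A(1) by auto
    then show ?thesis
      using a x by (auto simp: prob_nbhd_def dist_H0_less_iff[OF t])
  qed
  then show ?thesis
    using A(1,2) by (intro exI[of _ A]) auto
qed

theorem theorem5:
  fixes K :: "'a set"
    and D :: "'a \<Rightarrow> 'a \<Rightarrow> ddf"
    and star :: "ddf \<Rightarrow> ddf \<Rightarrow> ddf"
  assumes "prob_metric_space K D star"
    and "prob_complete K D"
    and "continuous_triangle_function star"
  shows "(prob_compact K D \<longleftrightarrow>
            compact_space (Metric_space.mtopology (Lip1_star K D star) (sup_dist K))) \<and>
         (compact_space (Metric_space.mtopology (Lip1_star K D star) (sup_dist K)) \<longleftrightarrow>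
            compactin (Metric_space.mtopology (C_star K D) (sup_dist K)) (Lip1_star K D star)) \<and>
         C_star K D = C_sigma K D"
proof (intro conjI)
  interpret lip: Metric_space "Lip1_star K D star" "sup_dist K"
    by (rule Metric_space_Lip1_star)
  show "prob_compact K D \<longleftrightarrow> compact_space lip.mtopology"
    \<comment> \<open>Completeness holds on both sides, so the equivalence reduces to finite covers
      of \<open>K\<close> versus total boundedness of the 1-Lipschitz maps.\<close>
    unfolding lip.compact_space_eq_mcomplete_mtotally_bounded
  proof
    assume "prob_compact K D"
    then show "lip.mcomplete \<and> lip.mtotally_bounded (Lip1_star K D star)"
      using Lip1_star_mcomplete[OF assms(3)] Lip1_star_mtotally_bounded[OF assms(1,3)]
      by (simp add: prob_compact_def)
  next
    assume "lip.mcomplete \<and> lip.mtotally_bounded (Lip1_star K D star)"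
    then show "prob_compact K D"
      using assms(2) finite_cover_of_mtotally_bounded_Lip1_star[OF assms(1)]
      by (simp add: prob_compact_def)
  qed
  interpret cstar: Metric_space "C_star K D" "sup_dist K"
    by (rule Metric_space_C_star)
  \<comment> \<open>The metric topology of the 1-Lipschitz maps is the subspace topology, so both
    notions of compactness agree.\<close>
  interpret sub: Submetric "C_star K D" "sup_dist K" "Lip1_star K D star"
    by unfold_locales (rule Lip1_star_subset_C_star[OF assms(1,3)])
  show "compact_space lip.mtopology \<longleftrightarrow> compactin cstar.mtopology (Lip1_star K D star)"
    using sub.subset by (simp add: compactin_subspace sub.mtopology_submetric)
  show "C_star K D = C_sigma K D"
    by (rule C_star_eq_C_sigma[OF assms(1,3)])
qed

end
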